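(* Let $k\ge 1$ and $n$ be integers, let $\mathcal{F}\subseteq \binom{[n]}{k}$, and assume that $n\ge (k^3+2k^2+k)/2$. Then \[ \Phi_{n,k}(\mathcal{F})=\sum_{A\in \mathcal{F}}\frac{1}{\binom{n-i_{\mathcal{F}}(A)}{k-i_{\mathcal{F}}(A)}}\le 1. \] Moreover, equality holds if and only if $\mathcal{F}$ is a $c$-star for some $0\le c\le k$.
   Context: $\binom{[n]}{k}$ denotes the family of all $k$-element subsets of $[n]=\{1,\dots,n\}$. For $\mathcal{F}\subseteq\binom{[n]}{k}$ and $A\in\mathcal{F}$, $i_{\mathcal{F}}(A):=\min_{B\in\mathcal{F}}|A\cap B|$. A $c$-star is the family of all $k$-subsets of $[n]$ containing a fixed $c$-element set. *)

theory Defs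
  imports Complex_Main
begin

definition k_subsets :: "nat \<Rightarrow> nat \<Rightarrow> nat set set" where
  "k_subsets n k = {A. A \<subseteq> {1..n} \<and> card A = k}"

text \<open>
  The minimum ranges over all \<open>B \<in> \<F>\<close>, including \<open>B = A\<close>. It is only meaningful for finite
  nonempty \<open>\<F>\<close>.
\<close>
definition min_inter :: "nat set set \<Rightarrow> nat set \<Rightarrow> nat" where
  "min_inter \<F> A = Min ((\<lambda>B. card (A \<inter> B)) ` \<F>)"

text \<open>
  For \<open>A \<in> \<F> \<subseteq> k_subsets n k\<close> we have \<open>min_inter \<F> A \<le> k \<le> n\<close>, so neither natural-number
  subtraction truncates.
\<close>
definition Phi :: "nat \<Rightarrow> nat \<Rightarrow> nat set set \<Rightarrow> real" where
  "Phi n k \<F> =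
     (\<Sum>A\<in>\<F>. 1 / real ((n - min_inter \<F> A) choose (k - min_inter \<F> A)))"

definition is_star :: "nat \<Rightarrow> nat \<Rightarrow> nat \<Rightarrow> nat set set \<Rightarrow> bool" where
  "is_star n k c \<F> \<longleftrightarrow>
     (\<exists>C. C \<subseteq> {1..n} \<and> card C = c \<and> \<F> = {A \<in> k_subsets n k. C \<subseteq> A})"

end

theory Submission
  imports Defs
begin

text \<open>
  Split \<open>\<F>\<close> into the levels \<open>L t = {A \<in> \<F>. min_inter \<F> A = t}\<close>. If some \<open>C\<close> lies in all members
  and every \<open>min_inter \<F> A\<close> equals \<open>card C\<close>, then \<open>\<F>\<close> is part of the star of \<open>C\<close> and \<open>Phi\<close> is the
  proportion of that star which it fills. Otherwise the level \<open>k\<close> is empty and no other level behaves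
  like a full star: a common \<open>t\<close>-set of \<open>L t\<close> is either missed by some member of \<open>\<F>\<close>, or there is a
  member of \<open>\<F>\<close> meeting all of \<open>L t\<close> in more than \<open>t\<close> points, so each set of \<open>L t\<close> must hit a small
  set outside the kernel. Hence \<open>L t\<close> has about at most \<open>(k + 1) * (n - t - 1 choose k - t - 1)\<close>
  elements, and summing the weights gives less than 1.

  The bound for \<open>t\<close>-intersecting families without a kernel comes from peeling: replace members by
  proper subsets as long as the family stays \<open>t\<close>-intersecting, split off the members of the largest
  size \<open>q\<close> (few, because each is found by branching at most \<open>q + 1 - t\<close> ways per element), and repeat
  until only sets of size at most \<open>t + 1\<close> remain.
\<close>

section \<open>Intersecting families and the \<open>k\<close>-sets above them\<close>

text \<open>Since \<open>B = A\<close> is allowed, every member has at least \<open>t\<close>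
  elements.\<close>

definition t_intersecting :: "nat \<Rightarrow> 'a set set \<Rightarrow> bool" where
  "t_intersecting t T \<longleftrightarrow> (\<forall>A\<in>T. \<forall>B\<in>T. t \<le> card (A \<inter> B))"

definition upper :: "'a set \<Rightarrow> nat \<Rightarrow> 'a set set \<Rightarrow> 'a set set" where
  "upper V k T = {G. G \<subseteq> V \<and> card G = k \<and> (\<exists>A\<in>T. A \<subseteq> G)}"

lemma finite_upper: "finite V \<Longrightarrow> finite (upper V k T)"
  unfolding upper_def by (rule finite_subset[of _ "Pow V"]) auto

lemma card_supersets:
  assumes "finite V" "S \<subseteq> V" "card S \<le> k"
  shows "card {G. G \<subseteq> V \<and> card G = k \<and> S \<subseteq> G} = (card V - card S) choose (k - card S)"
proof -
  have fS: "finite S" using assms finite_subset by blast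
  have "bij_betw (\<lambda>H. H \<union> S) {H. H \<subseteq> V - S \<and> card H = k - card S}
      {G. G \<subseteq> V \<and> card G = k \<and> S \<subseteq> G}"
  proof (rule bij_betw_byWitness[where f' = "\<lambda>G. G - S"])
    show "(\<lambda>H. H \<union> S) ` {H. H \<subseteq> V - S \<and> card H = k - card S}
        \<subseteq> {G. G \<subseteq> V \<and> card G = k \<and> S \<subseteq> G}"
    proof safe
      fix H assume H: "H \<subseteq> V - S" "card H = k - card S"
      have "finite H" using H assms(1) by (meson finite_Diff finite_subset)
      moreover have "H \<inter> S = {}" using H by auto
      ultimately show "card (H \<union> S) = k" using H fS assms(3) by (simp add: card_Un_disjoint)
    qed (use assms(2) in auto)
    show "(\<lambda>G. G - S) ` {G. G \<subseteq> V \<and> card G = k \<and> S \<subseteq> G}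
        \<subseteq> {H. H \<subseteq> V - S \<and> card H = k - card S}"
      using fS by (auto simp: card_Diff_subset)
  qed auto
  then have "card {G. G \<subseteq> V \<and> card G = k \<and> S \<subseteq> G} = card {H. H \<subseteq> V - S \<and> card H = k - card S}"
    by (simp add: bij_betw_same_card)
  also have "\<dots> = card (V - S) choose (k - card S)"
    using assms(1) by (simp add: n_subsets)
  also have "card (V - S) = card V - card S"
    using fS assms(2) by (simp add: card_Diff_subset)
  finally show ?thesis .
qed

lemma card_upper_le:
  assumes "finite V" "finite T" "\<And>A. A \<in> T \<Longrightarrow> A \<subseteq> V \<and> card A = s" "s \<le> k"
  shows "card (upper V k T) \<le> card T * ((card V - s) choose (k - s))"
proof -
  have "upper V k T = (\<Union>A\<in>T. {G. G \<subseteq> V \<and> card G = k \<and> A \<subseteq> G})"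
    unfolding upper_def by auto
  then have "card (upper V k T) \<le> (\<Sum>A\<in>T. card {G. G \<subseteq> V \<and> card G = k \<and> A \<subseteq> G})"
    using card_UN_le[OF assms(2)] by simp
  also have "\<dots> = (\<Sum>A\<in>T. (card V - s) choose (k - s))"
    using assms by (intro sum.cong refl) (simp add: card_supersets)
  finally show ?thesis by simp
qed

section \<open>Transversals and branching in minimal families\<close>

text \<open>A set that misses \<open>card F + 1 - t\<close> points of \<open>F\<close> keeps at most
  \<open>t - 1\<close> of them, so any \<open>Y\<close> of that size inside \<open>F - X\<close>
  must be hit. There is room for it because \<open>X\<close> covers fewer than \<open>t\<close>
  points of \<open>F\<close>.\<close>

lemma obtain_transversal:
  assumes "finite F" "card F \<le> q" "card (X \<inter> F) < t"
  obtains Y where "Y \<subseteq> F - X" "card Y \<le> q + 1 - t"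
    "\<And>A. X \<subseteq> A \<Longrightarrow> t \<le> card (A \<inter> F) \<Longrightarrow> A \<inter> Y \<noteq> {}"
proof -
  have c: "card (F - X) = card F - card (X \<inter> F)"
    using assms(1) by (simp add: card_Diff_subset_Int Int_commute)
  then obtain Y where Y: "Y \<subseteq> F - X" "card Y = card F + 1 - t"
    using obtain_subset_with_card_n[of "card F + 1 - t" "F - X"] assms(3)
    by (metis Suc_eq_plus1 Suc_leI diff_Suc_Suc diff_le_mono2)
  have "A \<inter> Y \<noteq> {}" if A: "X \<subseteq> A" "t \<le> card (A \<inter> F)" for A
  proof
    assume e: "A \<inter> Y = {}"
    \<comment> \<open>If \<open>card F < t\<close>, then \<open>Y\<close> is empty and no
      \<open>A\<close> qualifies.\<close>
    have "t \<le> card F" using A(2) card_mono[OF assms(1), of "A \<inter> F"] by auto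
    have "A \<inter> F \<subseteq> F - Y" using e by auto
    then have "card (A \<inter> F) \<le> card (F - Y)" by (simp add: assms(1) card_mono)
    also have "\<dots> = card F - card Y"
      using Y assms(1) by (metis Diff_subset card_Diff_subset finite_subset subset_trans)
    also have "\<dots> < t" using Y(2) \<open>t \<le> card F\<close> assms(3) by linarith
    finally show False using A by simp
  qed
  then show ?thesis using that Y assms(2) by (metis add_le_cancel_right diff_le_mono)
qed

lemma card_le_of_transversal:
  assumes "finite Y" "card Y \<le> b" "\<And>A. A \<in> \<W> \<Longrightarrow> A \<inter> Y \<noteq> {}"
    "\<And>y. y \<in> Y \<Longrightarrow> card {A \<in> \<W>. y \<in> A} \<le> N"
  shows "card \<W> \<le> b * (N::nat)"
proof -
  have "\<W> = (\<Union>y\<in>Y. {A \<in> \<W>. y \<in> A})" using assms(3) by auto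
  then have "card \<W> \<le> (\<Sum>y\<in>Y. card {A \<in> \<W>. y \<in> A})"
    using card_UN_le[OF assms(1)] by metis
  also have "\<dots> \<le> card Y * N" using assms(4) sum_bounded_above[of Y _ N] by simp
  also have "\<dots> \<le> b * N" using assms(2) by simp
  finally show ?thesis .
qed

text \<open>By minimality a proper subset \<open>X\<close> of a member meets some \<open>F\<close>
  in fewer than \<open>t\<close> points, while all members meet \<open>F\<close> in at least
  \<open>t\<close>. So each \<open>q\<close>-set above \<open>X\<close> contains one of at most
  \<open>q + 1 - t\<close> further points, and this branching repeats until \<open>X\<close> has
  \<open>q\<close> elements.\<close>

lemma card_minimal_level_above:
  assumes fin: "\<And>A. A \<in> T \<Longrightarrow> finite A \<and> card A \<le> q" and "t_intersecting t T"
    and min: "\<And>W X. W \<in> T \<Longrightarrow> X \<subset> W \<Longrightarrow> \<exists>F\<in>T. card (X \<inter> F) < t"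
    and "finite X" "card X \<le> q"
  shows "card {A \<in> T. card A = q \<and> X \<subseteq> A} \<le> (q + 1 - t) ^ (q - card X)"
  using assms(4,5)
proof (induction "q - card X" arbitrary: X)
  case 0
  then have "card X = q" by simp
  then have "{A \<in> T. card A = q \<and> X \<subseteq> A} \<subseteq> {X}"
  proof (intro subsetI)
    fix A assume "A \<in> {A \<in> T. card A = q \<and> X \<subseteq> A}"
    then show "A \<in> {X}" using card_subset_eq[of A X] fin[of A] \<open>card X = q\<close> by simp
  qed
  then have "card {A \<in> T. card A = q \<and> X \<subseteq> A} \<le> card {X}" by (intro card_mono) auto
  then show ?case using 0 by simp
next
  case (Suc m)
  show ?case
  \<comment> \<open>Minimality only speaks about proper subsets of members, so branching starts only
    if some \<open>q\<close>-set of \<open>T\<close> lies above \<open>X\<close>.\<close>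
  proof (cases "{A \<in> T. card A = q \<and> X \<subseteq> A} = {}")
    case False
    then obtain W where W: "W \<in> T" "card W = q" "X \<subseteq> W" by auto
    then have "X \<subset> W" using Suc by auto
    then obtain F where F: "F \<in> T" "card (X \<inter> F) < t" using min W by blast
    obtain Y where Y: "Y \<subseteq> F - X" "card Y \<le> q + 1 - t"
      "\<And>A. X \<subseteq> A \<Longrightarrow> t \<le> card (A \<inter> F) \<Longrightarrow> A \<inter> Y \<noteq> {}"
      using obtain_transversal[of F q X t] fin F by blast
    have "card {A \<in> T. card A = q \<and> X \<subseteq> A} \<le> (q + 1 - t) * (q + 1 - t) ^ m"
    proof (rule card_le_of_transversal[of Y])
      show "finite Y" using Y fin F by (meson finite_Diff finite_subset)
      show "A \<inter> Y \<noteq> {}" if "A \<in> {A \<in> T. card A = q \<and> X \<subseteq> A}" for A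
        using that Y F assms(2) unfolding t_intersecting_def by blast
      fix y assume "y \<in> Y"
      then have y: "y \<notin> X" using Y by auto
      then have c: "card (insert y X) = Suc (card X)" using Suc by simp
      have "{A \<in> {A \<in> T. card A = q \<and> X \<subseteq> A}. y \<in> A} = {A \<in> T. card A = q \<and> insert y X \<subseteq> A}"
        by auto
      then show "card {A \<in> {A \<in> T. card A = q \<and> X \<subseteq> A}. y \<in> A} \<le> (q + 1 - t) ^ m"
        using Suc.hyps(1)[of "insert y X"] Suc.hyps(2) Suc.prems c
        by (metis Suc_diff_Suc Suc_leI diff_Suc_1 diff_is_0_eq finite_insert nat.distinct(1) not_le)
    qed (use Y in auto)
    then show ?thesis using Suc.hyps(2) by (metis power_Suc)
  qed (simp only: card.empty le0)
qed

text \<open>Each \<open>q\<close>-set of \<open>T\<close> shares a \<open>t\<close>-subset with one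
  fixed \<open>q\<close>-set \<open>F\<close>; branching starts from each of these subsets.\<close>

lemma card_minimal_level:
  assumes fin: "\<And>A. A \<in> T \<Longrightarrow> finite A \<and> card A \<le> q" and int: "t_intersecting t T"
    and min: "\<And>W X. W \<in> T \<Longrightarrow> X \<subset> W \<Longrightarrow> \<exists>F\<in>T. card (X \<inter> F) < t"
    and "t \<le> q"
  shows "card {A \<in> T. card A = q} \<le> (q choose t) * (q + 1 - t) ^ (q - t)"
proof (cases "{A \<in> T. card A = q} = {}")
  case False
  then obtain F where F: "F \<in> T" "card F = q" by auto
  let ?I = "{X. X \<subseteq> F \<and> card X = t}"
  have fF: "finite F" using fin F by blast
  then have fI: "finite ?I" by simp
  have "{A \<in> T. card A = q} = (\<Union>X\<in>?I. {A \<in> T. card A = q \<and> X \<subseteq> A})"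
  proof safe
    fix A assume A: "A \<in> T" "q = card A"
    then have "t \<le> card (A \<inter> F)" using int F unfolding t_intersecting_def by blast
    then obtain X where "X \<subseteq> A \<inter> F" "card X = t" by (meson obtain_subset_with_card_n)
    then show "A \<in> (\<Union>X\<in>?I. {A' \<in> T. card A' = card A \<and> X \<subseteq> A'})" using A by auto
  qed
  then have "card {A \<in> T. card A = q} \<le> (\<Sum>X\<in>?I. card {A \<in> T. card A = q \<and> X \<subseteq> A})"
    using card_UN_le[OF fI, of "\<lambda>X. {A \<in> T. card A = q \<and> X \<subseteq> A}"] by argo
  also have "\<dots> \<le> (\<Sum>X\<in>?I. (q + 1 - t) ^ (q - t))"
  proof (rule sum_mono)
    fix X assume X: "X \<in> ?I"
    then have "finite X" using fF finite_subset by auto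
    then show "card {A \<in> T. card A = q \<and> X \<subseteq> A} \<le> (q + 1 - t) ^ (q - t)"
      using card_minimal_level_above[OF fin int min, where X = X] X assms(4) by auto
  qed
  also have "\<dots> = (q choose t) * (q + 1 - t) ^ (q - t)"
    using F fF by (simp add: n_subsets)
  finally show ?thesis .
qed (simp only: card.empty)

section \<open>Peeling an intersecting family\<close>

text \<open>The known dichotomy: such sets either have a common \<open>t\<close>-set or all lie in
  one set of size \<open>t + 2\<close>, which has \<open>t + 2\<close> subsets of size
  \<open>t + 1\<close>.\<close>

lemma t_intersecting_Suc_sets:
  assumes int: "t_intersecting t T"
    and c: "\<And>A. A \<in> T \<Longrightarrow> finite A \<and> card A = Suc t"
    and no: "\<And>C. card C = t \<Longrightarrow> finite C \<Longrightarrow> \<exists>A\<in>T. \<not> C \<subseteq> A"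
  shows "card T \<le> t + 2"
proof (cases "\<exists>A\<in>T. \<exists>B\<in>T. A \<noteq> B")
  case True
  then obtain A B where AB: "A \<in> T" "B \<in> T" "A \<noteq> B" by auto
  note f = c[OF AB(1)] c[OF AB(2)]
  define C where "C = A \<inter> B"
  have "C \<subset> A"
    using AB f unfolding C_def by (metis Int_lower1 Int_lower2 card_subset_eq psubsetI)
  then have cC: "card C = t" 
    using psubset_card_mono[of A C] f int AB unfolding t_intersecting_def C_def by fastforce
  have fC: "finite C" using f C_def by simp
  obtain D where D: "D \<in> T" "\<not> C \<subseteq> D" using no[OF cC fC] by auto
  \<comment> \<open>Two intersections of size at least \<open>t\<close> that overlap in fewer than
    \<open>t\<close> points fill all \<open>t + 1\<close> points of \<open>E\<close>.\<close>
  have key: "E \<subseteq> A \<union> B" if E: "E \<in> T" "\<not> C \<subseteq> E" for E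
  proof -
    have fE: "finite E" "card E = Suc t" using c E by auto
    have "C \<inter> E \<subset> C" using E by auto
    then have 1: "card (C \<inter> E) < t" using psubset_card_mono[OF fC] cC by metis
    have "t \<le> card (E \<inter> A)" "t \<le> card (E \<inter> B)"
      using int E AB unfolding t_intersecting_def by auto
    moreover have "card (E \<inter> A) + card (E \<inter> B) = card (E \<inter> (A \<union> B)) + card (C \<inter> E)"
    proof -
      have "E \<inter> A \<union> E \<inter> B = E \<inter> (A \<union> B)" "(E \<inter> A) \<inter> (E \<inter> B) = C \<inter> E" unfolding C_def by auto
      then show ?thesis using card_Un_Int[of "E \<inter> A" "E \<inter> B"] fE by simp
    qed
    ultimately have "Suc t \<le> card (E \<inter> (A \<union> B))" using 1 by linarith
    then show ?thesis using fE
      by (metis Int_lower1 Int_lower2 card_seteq)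
  qed
  have key2: "E \<subseteq> A \<union> B" if E: "E \<in> T" for E
  proof (cases "C \<subseteq> E")
    case True
    have fE: "finite E" "card E = Suc t" using c E by auto
    show ?thesis
    \<comment> \<open>A point \<open>e\<close> outside \<open>A \<union> B\<close> makes
      \<open>E\<close> equal to \<open>insert e C\<close>. But \<open>D\<close> lies in
      \<open>A \<union> B\<close> and does not contain \<open>C\<close>, so \<open>E\<close> and
      \<open>D\<close> share fewer than \<open>t\<close> points.\<close>
    proof (rule ccontr)
      assume "\<not> E \<subseteq> A \<union> B"
      then obtain e where e: "e \<in> E" "e \<notin> A \<union> B" by auto
      have "insert e C = E"
        using True e fE fC cC unfolding C_def by (intro card_subset_eq) auto
      then have "E \<inter> D = C \<inter> D" using key[OF D] e by auto
      moreover have "card (C \<inter> D) < card C" using D fC by (intro psubset_card_mono) auto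
      ultimately show False using int E D cC unfolding t_intersecting_def
        by (metis not_le)
    qed
  qed (use key E in blast)
  have fin: "finite (A \<union> B)" using f by simp
  have "card (A \<union> B) + card C = 2 * Suc t"
    using card_Un_Int[of A B] f unfolding C_def by simp
  then have cU: "card (A \<union> B) = t + 2" using cC by simp
  have "card T \<le> card {X. X \<subseteq> A \<union> B \<and> card X = Suc t}"
    using key2 c fin by (intro card_mono) auto
  also have "\<dots> = (t + 2) choose (Suc t)" using fin cU by (simp add: n_subsets)
  also have "\<dots> = t + 2" by simp
  finally show ?thesis .
next
  case False
  then obtain A where "T \<subseteq> {A}" by blast
  then have "card T \<le> 1" using card_mono[of "{A}" T] by simp
  then show ?thesis by simp
qed

text \<open>The two end states of peeling: a kernel of size \<open>t\<close>, or few sets one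
  element larger. The empty family belongs to the second.\<close>

definition peel_base :: "'a set \<Rightarrow> nat \<Rightarrow> 'a set set \<Rightarrow> bool" where
  "peel_base V t T \<longleftrightarrow> (\<exists>C. C \<subseteq> V \<and> card C = t \<and> T = {C}) \<or>
     finite T \<and> card T \<le> t + 2 \<and> (\<forall>A\<in>T. A \<subseteq> V \<and> card A = Suc t)"

text \<open>The summand for \<open>s\<close> bounds the \<open>k\<close>-sets above the members of
  size \<open>s\<close> that peeling splits off: the bound of \<open>card_minimal_level\<close>
  times the number of supersets of one member.\<close>

definition peel_bound :: "nat \<Rightarrow> nat \<Rightarrow> nat \<Rightarrow> nat \<Rightarrow> nat" where
  "peel_bound n k t q =
     (\<Sum>s = t + 2..q. (s choose t) * (s + 1 - t) ^ (s - t) * ((n - s) choose (k - s)))"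

text \<open>Either some member can be shrunk, which only enlarges \<open>upper V k T\<close>, or the
  family is minimal and its members of size \<open>q\<close> are few enough to be dropped. In both
  cases \<open>q\<close> plus the total size decreases.\<close>

lemma peeling:
  assumes "finite V" "t_intersecting t T" "\<And>A. A \<in> T \<Longrightarrow> A \<subseteq> V \<and> card A \<le> q"
    "Suc t \<le> q" "q \<le> k"
  shows "\<exists>T'. peel_base V t T' \<and>
    card (upper V k T - upper V k T') \<le> peel_bound (card V) k t q"
  using assms(2-)
proof (induction "q + (\<Sum>A\<in>T. card A)" arbitrary: q T rule: less_induct)
  case less
  note int = less.prems(1) and sub = less.prems(2)
  have fA: "finite A" if "A \<in> T" for A
    using sub[OF that] assms(1) finite_subset by blast
  have fT: "finite T" using sub assms(1) by (meson PowI finite_Pow_iff finite_subset subsetI)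
  show ?case
  proof (cases "q = Suc t")
    case True
    have ge: "t \<le> card A" if "A \<in> T" for A
      using int that unfolding t_intersecting_def by (metis Int_absorb)
    show ?thesis
    proof (cases "\<exists>C. C \<subseteq> V \<and> card C = t \<and> (\<forall>A\<in>T. C \<subseteq> A)")
      case True
      then obtain C where C: "C \<subseteq> V" "card C = t" "\<forall>A\<in>T. C \<subseteq> A" by auto
      have "upper V k T \<subseteq> upper V k {C}"
      proof
        fix G assume "G \<in> upper V k T"
        then obtain A where "G \<subseteq> V" "card G = k" "A \<in> T" "A \<subseteq> G" unfolding upper_def by auto
        moreover from this have "C \<subseteq> G" using C(3) by (meson subset_trans)
        ultimately show "G \<in> upper V k {C}" unfolding upper_def by simp
      qed
      then have "upper V k T - upper V k {C} = {}" by simp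
      moreover have "peel_base V t {C}" using C unfolding peel_base_def by auto
      ultimately show ?thesis by (metis card.empty le0)
    next
      case no: False
      \<comment> \<open>A member of size \<open>t\<close> meets every member in at least
        \<open>t\<close> points, hence lies in all of them and would be a kernel.\<close>
      have "card A = Suc t" if A: "A \<in> T" for A
      proof (rule ccontr)
        assume "card A \<noteq> Suc t"
        then have cA: "card A = t" using ge[OF A] sub[OF A] True by simp
        have "A \<subseteq> B" if "B \<in> T" for B
        proof -
          have "card A \<le> card (A \<inter> B)" using int A that cA unfolding t_intersecting_def by auto
          then show ?thesis using fA[OF A] by (metis Int_lower1 card_seteq inf.orderI)
        qed
        then show False using no cA sub[OF A] by blast
      qed
      moreover have "card T \<le> t + 2"
      proof (cases "T = {}")
        case False
        show ?thesis
        proof (rule t_intersecting_Suc_sets[OF int])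
          fix C :: "'a set" assume "card C = t" "finite C"
          then show "\<exists>A\<in>T. \<not> C \<subseteq> A" using no sub False by (metis ex_in_conv subset_trans)
        qed (use fA calculation in auto)
      qed simp
      ultimately have "peel_base V t T" unfolding peel_base_def using sub fT by auto
      then show ?thesis by (metis Diff_cancel card.empty le0)
    qed
  next
    case False
    then have q: "Suc t < q" using less.prems(3) by simp
    show ?thesis
    proof (cases "\<exists>W\<in>T. \<exists>X. X \<subset> W \<and> (\<forall>F\<in>T. t \<le> card (X \<inter> F))")
      case True
      then obtain W X where W: "W \<in> T" "X \<subset> W" "\<And>F. F \<in> T \<Longrightarrow> t \<le> card (X \<inter> F)" by auto
      define T1 where "T1 = insert X (T - {W})"
      have "X \<inter> W = X" using W by auto
      then have "t \<le> card X" using W(3)[OF W(1)] by simp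
      then have int1: "t_intersecting t T1"
        using int W(3) unfolding t_intersecting_def T1_def by (auto simp: Int_commute)
      have cX: "card X < card W" using W fA psubset_card_mono by blast
      have sub1: "A \<subseteq> V \<and> card A \<le> q" if "A \<in> T1" for A
        using that sub W(1,2) sub[OF W(1)] cX unfolding T1_def by fastforce
      have "(\<Sum>A\<in>T1. card A) \<le> card X + (\<Sum>A\<in>T - {W}. card A)"
        unfolding T1_def using fT by (simp add: sum.insert_if)
      also have "\<dots> < card W + (\<Sum>A\<in>T - {W}. card A)" using cX by simp
      also have "\<dots> = (\<Sum>A\<in>T. card A)" using sum.remove[OF fT W(1), of card] by simp
      finally have "q + (\<Sum>A\<in>T1. card A) < q + (\<Sum>A\<in>T. card A)" by simp
      from less.hyps[OF this int1 sub1 less.prems(3,4)] obtain T' where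
        T': "peel_base V t T'" "card (upper V k T1 - upper V k T') \<le> peel_bound (card V) k t q"
        by blast
      have "upper V k T \<subseteq> upper V k T1"
      proof
        fix G assume "G \<in> upper V k T"
        then obtain A where A: "G \<subseteq> V" "card G = k" "A \<in> T" "A \<subseteq> G" unfolding upper_def by auto
        then have "(if A = W then X else A) \<in> T1" "(if A = W then X else A) \<subseteq> G"
          using W(2) unfolding T1_def by auto
        then show "G \<in> upper V k T1" using A(1,2) unfolding upper_def by blast
      qed
      then have "card (upper V k T - upper V k T') \<le> card (upper V k T1 - upper V k T')"
        using finite_upper[OF assms(1)] by (intro card_mono) auto
      then show ?thesis using T' by (meson le_trans)
    next
      case minimal: False
      define W where "W = {A \<in> T. card A = q}"
      have cW: "card W \<le> (q choose t) * (q + 1 - t) ^ (q - t)"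
        unfolding W_def
      proof (rule card_minimal_level[OF _ int])
        show "\<exists>F\<in>T. card (X \<inter> F) < t" if "W \<in> T" "X \<subset> W" for W X
          using minimal that by (meson not_le)
      qed (use fA sub q in auto)
      have sub1: "A \<subseteq> V \<and> card A \<le> q - 1" if "A \<in> T - W" for A
      proof -
        have "A \<in> T" "card A \<noteq> q" using that unfolding W_def by auto
        then show ?thesis using sub[of A] by linarith
      qed
      have int1: "t_intersecting t (T - W)" using int unfolding t_intersecting_def by auto
      have "(\<Sum>A\<in>T - W. card A) \<le> (\<Sum>A\<in>T. card A)"
        using fT by (intro sum_mono2) auto
      \<comment> \<open>Even if no member has size \<open>q\<close>, the measure drops because
        \<open>q\<close> does.\<close>
      then have "q - 1 + (\<Sum>A\<in>T - W. card A) < q + (\<Sum>A\<in>T. card A)" using q by linarith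
      moreover have "Suc t \<le> q - 1" "q - 1 \<le> k" using q less.prems(4) by auto
      ultimately obtain T' where
        T': "peel_base V t T'"
        "card (upper V k (T - W) - upper V k T') \<le> peel_bound (card V) k t (q - 1)"
        using less.hyps[of "q - 1" "T - W", OF _ int1 sub1] by auto
      have "upper V k T - upper V k T' \<subseteq> upper V k W \<union> (upper V k (T - W) - upper V k T')"
        unfolding upper_def by auto
      then have "card (upper V k T - upper V k T')
          \<le> card (upper V k W \<union> (upper V k (T - W) - upper V k T'))"
        using finite_upper[OF assms(1)] by (intro card_mono) auto
      also have "\<dots> \<le> card (upper V k W) + card (upper V k (T - W) - upper V k T')"
        by (rule card_Un_le)
      also have "card (upper V k W) \<le> card W * ((card V - q) choose (k - q))"
        using sub less.prems(4) fT unfolding W_def by (intro card_upper_le assms(1)) auto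
      also have "\<dots> \<le> (q choose t) * (q + 1 - t) ^ (q - t) * ((card V - q) choose (k - q))"
        using cW by (rule mult_right_mono) simp
      also note T'(2)
      also have "(q choose t) * (q + 1 - t) ^ (q - t) * ((card V - q) choose (k - q))
          + peel_bound (card V) k t (q - 1) = peel_bound (card V) k t q"
      proof -
        obtain p where p: "q = Suc p" "t + 2 \<le> Suc p" using q by (cases q) auto
        show ?thesis unfolding peel_bound_def p(1) using p(2) by (simp add: sum.atLeast_Suc_atMost)
      qed
      finally show ?thesis using T' by auto
    qed
  qed
qed

section \<open>Numerical estimates at the threshold\<close>

text \<open>
  \<open>peel_ratio k t n\<close> is \<open>peel_bound n k t k\<close> divided by \<open>(n - t - 1) choose (k - t - 1)\<close>, written for
  a real argument in place of \<open>n\<close> because it is then visibly decreasing in it.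
\<close>

definition peel_term :: "nat \<Rightarrow> nat \<Rightarrow> real \<Rightarrow> nat \<Rightarrow> real" where
  "peel_term k t x d = real ((t + d) choose t) * real (d + 1) ^ d *
     (\<Prod>j=1..<d. (real k - real t - real j) / (x - real t - real j))"

definition peel_ratio :: "nat \<Rightarrow> nat \<Rightarrow> real \<Rightarrow> real" where
  "peel_ratio k t x = (\<Sum>d=2..k-t. peel_term k t x d)"

text \<open>An upper bound for \<open>Phi\<close> without a kernel, at \<open>n = x\<close>: the
  first term stands for level 0, the summand \<open>t\<close> for level \<open>t\<close>. The
  fraction is the quotient of \<open>(n - t - 1) choose (k - t - 1)\<close> by
  \<open>(n - t) choose (k - t)\<close>.\<close>

definition level_total :: "nat \<Rightarrow> real \<Rightarrow> real" where
  "level_total k x = real k ^ 2 / x + (\<Sum>t=1..<k. (real k - real t) / (x - real t) *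
     (real (max (t + 2) (k - t + 1)) + peel_ratio k t x))"

lemma level_total_antimono:
  assumes "real k < x" "x \<le> y"
  shows "level_total k y \<le> level_total k x"
  unfolding level_total_def peel_ratio_def peel_term_def using assms
  by (intro add_mono sum_mono mult_mono divide_left_mono order_refl prod_mono conjI
      mult_nonneg_nonneg divide_nonneg_nonneg sum_nonneg add_nonneg_nonneg prod_nonneg mult_pos_pos)
    auto

lemma peel_term_nonneg: "real k < x \<Longrightarrow> d \<le> k - t \<Longrightarrow> 0 \<le> peel_term k t x d"
  unfolding peel_term_def
  by (intro mult_nonneg_nonneg prod_nonneg divide_nonneg_nonneg) auto

text \<open>Dividing by the power on the right leaves \<open>(1 + 1 / (d + 1)) ^ (d + 1)\<close>,
  which is at most \<open>exp 1\<close>.\<close>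

lemma Suc_Suc_power_le: "real (d + 2) ^ (d + 1) \<le> 3 * real (d + 1) ^ (d + 1)"
proof -
  have "(1 + 1 / real (d + 1)) ^ (d + 1) \<le> exp 1"
    using exp_ge_one_plus_x_over_n_power_n[of "d + 1" 1] by simp
  then have "(real (d + 2) / real (d + 1)) ^ (d + 1) \<le> 3"
    using exp_le by (simp add: field_simps)
  then show ?thesis unfolding power_divide by (subst (asm) pos_divide_le_eq) auto
qed

text \<open>Here \<open>x - k\<close> is \<open>k * ((k + 1)^2 - 2) / 2\<close>, so at least
  \<open>4 * (k + 1)^2 - 8\<close>, and \<open>(k + 1)^2 / 4\<close> absorbs the 8. The constant
  \<open>15 / 4\<close> yields the \<open>1 / 15\<close> in \<open>peel_term_Suc_le\<close>.\<close>

lemma threshold_ge: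
  assumes k: "8 \<le> k" and x: "x = real k * (real k + 1)^2 / 2"
  shows "15 * (real k + 1)^2 / 4 \<le> x - k"
proof -
  have "81 \<le> (real k + 1)^2"
    using power_mono[of 9 "real k + 1" 2] k by simp
  moreover from this have "real k * ((real k + 1)^2 - 2) \<ge> 8 * ((real k + 1)^2 - 2)"
    using k by (intro mult_right_mono) auto
  moreover have "x - k = real k * ((real k + 1)^2 - 2) / 2" unfolding x by (simp add: field_simps)
  ultimately show ?thesis by simp
qed

text \<open>From \<open>d\<close> to \<open>d + 1\<close> the binomial gains the factor
  \<open>(t + d + 1) / (d + 1)\<close>, the power at most \<open>3 * (d + 1)\<close>, and the
  product \<open>(k - t - d) / (x - t - d)\<close>. Together these are at most
  \<open>3 / 15\<close>.\<close>

lemma peel_term_Suc_le: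
  assumes k: "8 \<le> k" and x: "x = real k * (real k + 1)^2 / 2" and d: "d < k - t"
    and "1 \<le> d"
  shows "peel_term k t x (Suc d) \<le> peel_term k t x d / 5"
proof -
  define P where "P = (\<Prod>j=1..<d. (real k - real t - real j) / (x - real t - real j))"
  define C where "C = real ((t + d) choose t)"
  have xk: "15 * (real k + 1)^2 / 4 \<le> x - k" using threshold_ge[OF k x] .
  have "real t + real d < real k" using d by linarith
  then have xpos: "0 < x - real t - real d"
    using xk zero_le_power2[of "real k + 1"] by argo
  have P0: "0 \<le> P" unfolding P_def
    using d xpos by (intro prod_nonneg divide_nonneg_nonneg) auto
  have C0: "0 \<le> C" unfolding C_def by simp
  have "real (Suc d) * real (Suc (t + d) choose t) = real (Suc (t + d)) * C"
    using binomial_absorb_comp[of "Suc (t + d)" t] unfolding C_def of_nat_mult[symmetric]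
    by (simp add: Suc_diff_le)
  then have C1: "real (Suc (t + d) choose t) = real (t + d + 1) / real (d + 1) * C"
    by (simp add: field_simps)
  \<comment> \<open>AM-GM: the two factors add up to \<open>k + 1\<close>.\<close>
  have "4 * (real (t + d + 1) * (real k - real t - real d)) \<le> (real k + 1)^2"
    using zero_le_power2[of "real (t + d + 1) - (real k - real t - real d)"]
    by (simp add: power2_eq_square algebra_simps)
  then have m: "real (t + d + 1) * (real k - real t - real d) / (x - real t - real d) \<le> 1 / 15"
    using xk xpos d by (simp add: field_simps)
  have "peel_term k t x (Suc d) = real (Suc (t + d) choose t) * real (d + 2) ^ (d + 1) *
      (P * ((real k - real t - real d) / (x - real t - real d)))"
    using assms(4) unfolding peel_term_def P_def by (simp add: add.commute)
  also have "\<dots> \<le> real (Suc (t + d) choose t) * (3 * real (d + 1) ^ (d + 1)) *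
      (P * ((real k - real t - real d) / (x - real t - real d)))"
    using Suc_Suc_power_le[of d] P0 xpos d
    by (intro mult_right_mono mult_left_mono mult_nonneg_nonneg divide_nonneg_nonneg) auto
  also have "\<dots> = 3 * (C * real (d + 1) ^ d * P) *
      (real (t + d + 1) * (real k - real t - real d) / (x - real t - real d))"
    unfolding C1 by simp
  also have "\<dots> \<le> 3 * (C * real (d + 1) ^ d * P) * (1 / 15)"
    using P0 C0 m by (intro mult_left_mono mult_nonneg_nonneg) auto
  also have "\<dots> = peel_term k t x d / 5" unfolding peel_term_def C_def P_def by simp
  finally show ?thesis .
qed

text \<open>
  The bound is false for some smaller \<open>k\<close> (for instance \<open>k = 4\<close>, \<open>t = 1\<close>), which is why
  \<open>level_total\<close> is evaluated numerically for \<open>k \<le> 7\<close>.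
\<close>

lemma peel_ratio_le:
  assumes k: "8 \<le> k" and x: "x = real k * (real k + 1)^2 / 2" and t: "1 \<le> t" "t < k"
  shows "real (max (t + 2) (k - t + 1)) + peel_ratio k t x \<le> real k + 1"
proof (cases "t + 2 \<le> k")
  case True
  define m where "m = real k - real t - 1"
  define u where "u = real t"
  have ku: "1 \<le> u" "1 \<le> m" "u \<le> real k - 2" "8 \<le> real k"
    using True t k by (auto simp: m_def u_def)
  have xk: "15 * (real k + 1)^2 / 4 \<le> x - k" using threshold_ge[OF k x] .
  moreover have kk: "0 < (real k + 1)^2" by simp
  ultimately have x0: "real k < x" using kk by argo
  then have x1: "0 < x - u - 1" using ku by simp
  \<comment> \<open>The terms decay by a factor 5, so their sum is at most \<open>5 / 4\<close> of
    the first one.\<close>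
  have a: "peel_term k t x d \<le> peel_term k t x 2 * (1/5)^(d - 2)" if "2 \<le> d" "d \<le> k - t" for d
  proof -
    have "e + 2 \<le> k - t \<Longrightarrow> peel_term k t x (e + 2) \<le> peel_term k t x 2 * (1/5)^e" for e
    proof (induction e)
      case (Suc e)
      then show ?case using peel_term_Suc_le[OF k x, of "e + 2" t] by simp
    qed (simp add: numeral_2_eq_2)
    from this[of "d - 2"] show ?thesis using that by (metis le_add_diff_inverse2)
  qed
  have "(\<Sum>d=2..k-t. (1/5::real)^(d - 2)) = (\<Sum>d\<le>k - t - 2. (1/5)^d)"
    by (rule sum.reindex_bij_witness[of _ "\<lambda>d. d + 2" "\<lambda>d. d - 2"]) (use True in auto)
  also have "\<dots> \<le> (\<Sum>d. (1/5)^d)"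
    by (rule sum_le_suminf) auto
  also have "\<dots> = 5/4" by (subst suminf_geometric) auto
  finally have g: "(\<Sum>d=2..k-t. (1/5::real)^(d - 2)) \<le> 5/4" .
  have "peel_ratio k t x \<le> (\<Sum>d=2..k-t. peel_term k t x 2 * (1/5)^(d - 2))"
    unfolding peel_ratio_def using a by (intro sum_mono) auto
  also have "\<dots> = peel_term k t x 2 * (\<Sum>d=2..k-t. (1/5)^(d - 2))" by (simp add: sum_distrib_left)
  also have "\<dots> \<le> peel_term k t x 2 * (5/4)"
    using g True x0 by (intro mult_left_mono peel_term_nonneg) auto
  also have "peel_term k t x 2 = 9 * (u + 1) * (u + 2) * m / (2 * (x - u - 1))"
  proof -
    define b where "b = (t + 2) choose t"
    have "2 * b = (t + 2) * (t + 1)"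
      using binomial_absorb_comp[of "t + 2" t] unfolding b_def by (simp add: numeral_2_eq_2)
    then have "real (2 * b) = real ((t + 2) * (t + 1))" by (simp only:)
    then have "real b = (u + 2) * (u + 1) / 2" unfolding u_def by (simp add: algebra_simps)
    moreover have "peel_term k t x 2 = real b * 3^2 * (m / (x - u - 1))"
      unfolding peel_term_def m_def u_def b_def by (simp add: numeral_2_eq_2 numeral_3_eq_3)
    moreover have "(u + 2) * (u + 1) / 2 * 3^2 * (m / y) = 9 * (u + 1) * (u + 2) * m / (2 * y)" for y
      by (simp add: divide_simps)
    ultimately show ?thesis by (simp only:)
  qed
  also have "9 * (u + 1) * (u + 2) * m / (2 * (x - u - 1)) * (5 / 4)
      = 45 / 8 * ((u + 1) * (u + 2) * m) / (x - u - 1)"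
    using x1 by (simp add: divide_simps)
  finally have R: "peel_ratio k t x \<le> 45 / 8 * ((u + 1) * (u + 2) * m) / (x - u - 1)" .
  \<comment> \<open>It remains to bound the ratio by \<open>m\<close> and by \<open>u\<close>, the
    gaps from \<open>t + 2\<close> and \<open>k - t + 1\<close> to \<open>k + 1\<close>. This
    inequality serves the bound by \<open>m\<close>.\<close>
  have "45 / 8 * ((u + 1) * (u + 2)) \<le> x - u - 1"
  proof -
    have "(u + 1) * (u + 2) \<le> (real k - 1) * real k" using ku by (intro mult_mono) auto
    then have 1: "(u + 1) * (u + 2) \<le> real k * real k - real k" by (simp add: algebra_simps)
    \<comment> \<open>The goal reduces to \<open>4 * k^3 - 37 * k^2 + 41 * k + 8 >= 0\<close>; this
      product gives it up to the remainder \<open>k + 8\<close>.\<close>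
    have "0 \<le> real k * ((real k - 8) * (4 * real k - 5))" using ku by simp
    then have 2: "37 * (real k * real k) \<le> 40 * real k + 4 * (real k * real k * real k)"
      by (simp add: algebra_simps)
    have "x = (real k * real k * real k + 2 * (real k * real k) + real k) / 2"
      unfolding x by (simp add: power2_eq_square algebra_simps)
    then show ?thesis using ku(3,4) 1 2 by argo
  qed
  then have 1: "45 / 8 * ((u + 1) * (u + 2)) * m \<le> (x - u - 1) * m"
    using ku by (intro mult_right_mono) auto
  \<comment> \<open>For the bound by \<open>u\<close>: \<open>(u + 1) * (u + 2)\<close> is at most
    \<open>u * (u + 5)\<close>, and \<open>u + 5\<close> and \<open>m\<close> add up to
    \<open>k + 4\<close>, which is at most \<open>4 / 3 * (k + 1)\<close> from \<open>k = 8\<close>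
    on.\<close>
  have "45 / 8 * ((u + 5) * m) \<le> x - u - 1"
  proof -
    have "4 * ((u + 5) * m) \<le> (real k + 4)^2"
      using zero_le_power2[of "u + 5 - m"] unfolding m_def u_def
      by (simp add: power2_eq_square algebra_simps)
    moreover have "(real k + 4)^2 \<le> (4 / 3 * (real k + 1))^2"
      using ku by (intro power_mono) auto
    moreover have "(4 / 3 * (real k + 1))^2 = 16 / 9 * (real k + 1)^2"
      by (simp add: power2_eq_square algebra_simps)
    ultimately show ?thesis using ku(3) xk kk by linarith
  qed
  then have "u * (45 / 8 * ((u + 5) * m)) \<le> u * (x - u - 1)"
    using ku by (intro mult_left_mono) auto
  moreover have "(u + 1) * (u + 2) * m \<le> u * (u + 5) * m"
    using ku by (intro mult_right_mono) (auto simp: algebra_simps)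
  ultimately have 2: "45 / 8 * ((u + 1) * (u + 2) * m) \<le> u * (x - u - 1)" by (simp add: mult.assoc)
  have "peel_ratio k t x \<le> m" "peel_ratio k t x \<le> u"
    using 1 2 x1 by (auto intro!: order_trans[OF R] simp: pos_divide_le_eq mult_ac)
  then show ?thesis using t unfolding m_def u_def by (auto simp: max_def)
\<comment> \<open>For \<open>t = k - 1\<close> the sum is empty and
  \<open>t + 2 = k + 1\<close>.\<close>
qed (use t in \<open>auto simp: peel_ratio_def\<close>)

text \<open>Lowering all denominators to \<open>x - k\<close> and raising the brackets to
  \<open>k + 1\<close> gives a fraction whose numerator is exactly \<open>x - k\<close>; this is
  where the threshold comes from. Strictness comes from the first term,
  \<open>k^2 / x < k^2 / (x - k)\<close>.\<close>

lemma level_total_large: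
  assumes k: "8 \<le> k" and x: "x = real k * (real k + 1)^2 / 2"
  shows "level_total k x < 1"
proof -
  have kk: "0 < (real k + 1)^2" by simp
  have xk: "0 < x - k" using threshold_ge[OF k x] kk by argo
  have "level_total k x \<le> real k ^ 2 / x + (\<Sum>t=1..<k. (real k - real t) / (x - k) * (real k + 1))"
    unfolding level_total_def
  proof (intro add_mono order_refl sum_mono)
    fix t assume t: "t \<in> {1..<k}"
    have "0 \<le> peel_ratio k t x"
      unfolding peel_ratio_def using xk by (intro sum_nonneg peel_term_nonneg) auto
    then show "(real k - real t) / (x - real t) * (real (max (t + 2) (k - t + 1)) + peel_ratio k t x)
        \<le> (real k - real t) / (x - k) * (real k + 1)"
      using xk t peel_ratio_le[OF k x, of t] by (intro mult_mono divide_left_mono) auto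
  qed
  also have "\<dots> < real k ^ 2 / (x - k) + (\<Sum>t=1..<k. (real k - real t) / (x - k) * (real k + 1))"
    using xk k by (intro add_strict_right_mono divide_strict_left_mono mult_pos_pos) auto
  also have "(\<Sum>t=1..<k. (real k - real t) / (x - k) * (real k + 1))
      = (\<Sum>t=1..<k. real k - real t) * ((real k + 1) / (x - k))"
    by (simp add: sum_distrib_right sum_divide_distrib)
  also have "(\<Sum>t=1..<k. real k - real t) = real k * (real k - 1) / 2"
  proof -
    have "(\<Sum>t=1..<k. real k - real t) = (\<Sum>t=1..<k. real t)"
      by (rule sum.reindex_bij_witness[of _ "\<lambda>t. k - t" "\<lambda>t. k - t"]) auto
    also have "\<dots> = (\<Sum>t<k. real t)"
      using k by (subst lessThan_atLeast0) (simp add: sum.atLeast_Suc_lessThan)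
    also have "\<dots> = real k * (real k - 1) / 2" by (induction k) (auto simp: field_simps)
    finally show ?thesis .
  qed
  also have "real k ^ 2 / (x - k) + real k * (real k - 1) / 2 * ((real k + 1) / (x - k))
      = (real k ^ 2 + real k * (real k - 1) / 2 * (real k + 1)) / (x - k)"
    unfolding times_divide_eq_right by (rule add_divide_distrib[symmetric])
  also have "real k ^ 2 + real k * (real k - 1) / 2 * (real k + 1) = x - k"
    unfolding x by (simp add: power2_eq_square field_simps)
  also have "(x - k) / (x - k) = 1" using xk by simp
  finally show ?thesis .
qed

lemma level_total_small:
  assumes "1 \<le> k" "k \<le> 7"
  shows "level_total k (real k * (real k + 1)^2 / 2) < 1"
proof -
  have sets:
    "{1..<2} = {1::nat}" "{1..<3} = {1,2::nat}" "{1..<4} = {1,2,3::nat}" "{1..<5} = {1,2,3,4::nat}"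
    "{1..<6} = {1,2,3,4,5::nat}" "{1..<7} = {1,2,3,4,5,6::nat}"
    "{2..3} = {2,3::nat}" "{2..4} = {2,3,4::nat}" "{2..5} = {2,3,4,5::nat}" "{2..6} = {2,3,4,5,6::nat}"
    by auto
  note defs = level_total_def peel_ratio_def peel_term_def
  \<comment> \<open>The second arguments are \<open>k * (k + 1)^2 / 2\<close> for \<open>k\<close>
    from 1 to 7.\<close>
  have "level_total 1 2 < 1" unfolding defs by simp
  moreover have "level_total 2 9 < 1" unfolding defs
    by (simp add: sets del: One_nat_def)
  moreover have "level_total 3 24 < 1" unfolding defs
    by (simp add: sets del: One_nat_def) (simp add: choose_reduce_nat)
  moreover have "level_total 4 50 < 1" unfolding defs
    by (simp add: sets del: One_nat_def) (simp add: choose_reduce_nat)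
  moreover have "level_total 5 90 < 1" unfolding defs
    by (simp add: sets del: One_nat_def) (simp add: choose_reduce_nat)
  moreover have "level_total 6 147 < 1" unfolding defs
    by (simp add: sets del: One_nat_def) (simp add: choose_reduce_nat)
  moreover have "level_total 7 224 < 1" unfolding defs
    by (simp add: sets del: One_nat_def) (simp add: choose_reduce_nat)
  moreover have "k \<in> {1,2,3,4,5,6,7}" using assms by auto
  ultimately show ?thesis by (auto simp: power2_eq_square)
qed

lemma two_k_le_threshold:
  assumes "1 \<le> k"
  shows "2 * real k \<le> real k * (real k + 1)^2 / 2"
proof -
  have "2^2 \<le> (real k + 1)^2" using assms by (intro power_mono) auto
  then have "real k * 4 \<le> real k * (real k + 1)^2" by (intro mult_left_mono) auto
  then show ?thesis by simp
qed

lemma level_total_less_1: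
  assumes "1 \<le> k" and "real k * (real k + 1)^2 / 2 \<le> x"
  shows "level_total k x < 1"
proof -
  have "level_total k (real k * (real k + 1)^2 / 2) < 1"
    using level_total_small[OF assms(1)] level_total_large[OF _ refl] by (cases "8 \<le> k") auto
  moreover have "level_total k x \<le> level_total k (real k * (real k + 1)^2 / 2)"
    using two_k_le_threshold[OF assms(1)] assms by (intro level_total_antimono) auto
  ultimately show ?thesis by simp
qed

section \<open>Binomial quotients\<close>

text \<open>Iterates the quotient \<open>(K + 1) / (N + 1)\<close> of diagonal neighbours
  \<open>N choose K\<close> and \<open>(N + 1) choose (K + 1)\<close>; for \<open>d = 1\<close> the
  product is empty.\<close>

lemma binomial_quotient:
  assumes "1 \<le> d" "t + d \<le> k" "k \<le> n"
  shows "real ((n - (t + d)) choose (k - (t + d))) = real ((n - Suc t) choose (k - Suc t)) *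
    (\<Prod>j=1..<d. (real k - real t - real j) / (real n - real t - real j))"
  using assms
proof (induction d rule: dec_induct)
  case (step d)
  define N K where "N = n - (t + Suc d)" and "K = k - (t + Suc d)"
  have NK: "n - (t + d) = Suc N" "k - (t + d) = Suc K"
    "real n - real t - real d = real (Suc N)" "real k - real t - real d = real (Suc K)"
    using step unfolding N_def K_def by auto
  have "real (Suc K) * real (Suc N choose Suc K) = real (Suc N) * real (N choose K)"
    by (simp only: of_nat_mult[symmetric] Suc_times_binomial)
  then have "real (N choose K) = real (Suc N choose Suc K) * (real (Suc K) / real (Suc N))"
    by (simp add: field_simps)
  moreover have "real (Suc N choose Suc K) = real ((n - Suc t) choose (k - Suc t)) *
    (\<Prod>j=1..<d. (real k - real t - real j) / (real n - real t - real j))"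
    using step.IH step.prems by (simp add: NK(1,2))
  ultimately have "real (N choose K) = real ((n - Suc t) choose (k - Suc t)) *
    (\<Prod>j=1..<Suc d. (real k - real t - real j) / (real n - real t - real j))"
    using step.hyps(1) by (simp only: prod.atLeastLessThan_Suc NK(3,4) mult.assoc)
  then show ?case unfolding N_def K_def .
qed simp

lemma peel_bound_eq:
  assumes "t \<le> k" "k \<le> n"
  shows "real (peel_bound n k t k) = real ((n - Suc t) choose (k - Suc t)) * peel_ratio k t (real n)"
proof -
  have "real (peel_bound n k t k)
      = (\<Sum>d=2..k-t. real (((t + d) choose t) * (d + 1) ^ d * ((n - (t + d)) choose (k - (t + d)))))"
    unfolding peel_bound_def of_nat_sum
    by (rule sum.reindex_bij_witness[of _ "\<lambda>d. t + d" "\<lambda>s. s - t"])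
      (use assms in \<open>auto simp: Suc_diff_le\<close>)
  also have "\<dots> = (\<Sum>d=2..k-t. real ((n - Suc t) choose (k - Suc t)) * peel_term k t (real n) d)"
  proof (intro sum.cong refl)
    fix d assume d: "d \<in> {2..k-t}"
    have q: "real ((n - (t + d)) choose (k - (t + d))) = real ((n - Suc t) choose (k - Suc t)) *
        (\<Prod>j=1..<d. (real k - real t - real j) / (real n - real t - real j))"
      using d assms by (intro binomial_quotient) auto
    show "real (((t + d) choose t) * (d + 1) ^ d * ((n - (t + d)) choose (k - (t + d))))
        = real ((n - Suc t) choose (k - Suc t)) * peel_term k t (real n) d"
      unfolding peel_term_def of_nat_mult q of_nat_power by (simp only: mult_ac)
  qed
  finally show ?thesis unfolding peel_ratio_def by (simp only: sum_distrib_left)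
qed

section \<open>The size of one level\<close>

text \<open>Each member contains \<open>C\<close> and a point of \<open>Y\<close> outside it, so it
  lies above one of at most \<open>b\<close> sets of size \<open>t + 1\<close>.\<close>

lemma card_le_of_transversal_above:
  assumes V: "finite V" and C: "C \<subseteq> V" "card C = t" "t < k"
    and H: "\<And>G. G \<in> H \<Longrightarrow> G \<subseteq> V \<and> card G = k \<and> C \<subseteq> G"
    and Y: "Y \<subseteq> V - C" "card Y \<le> b" "\<And>G. G \<in> H \<Longrightarrow> G \<inter> Y \<noteq> {}"
  shows "card H \<le> b * ((card V - Suc t) choose (k - Suc t))"
proof (rule card_le_of_transversal[OF _ Y(2,3)])
  show "finite Y" using V Y(1) by (meson finite_Diff finite_subset)
  fix y assume "y \<in> Y"
  then have y: "y \<in> V" "y \<notin> C" using Y(1) by auto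
  have fC: "finite C" using C(1) V by (rule finite_subset)
  have c: "card (insert y C) = Suc t" using y C(2) fC by simp
  have "card {G \<in> H. y \<in> G} \<le> card {G. G \<subseteq> V \<and> card G = k \<and> insert y C \<subseteq> G}"
    using H V by (intro card_mono) (auto intro!: finite_subset[of _ "Pow V"])
  also have "\<dots> = (card V - Suc t) choose (k - Suc t)"
    using card_supersets[of V "insert y C" k] V C y(1) unfolding c by auto
  finally show "card {G \<in> H. y \<in> G} \<le> (card V - Suc t) choose (k - Suc t)" .
qed

text \<open>\<open>A\<close> and \<open>G\<close> share more than the \<open>t\<close> points of
  \<open>C\<close>, so \<open>G - C\<close> is a transversal with \<open>k - t\<close>
  points.\<close>

lemma card_level_above_kernel:
  assumes V: "finite V" and C: "C \<subseteq> V" "card C = t" "t < k"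
    and H: "\<And>A. A \<in> H \<Longrightarrow> A \<subseteq> V \<and> card A = k \<and> C \<subseteq> A \<and> t < card (A \<inter> G)"
    and G: "G \<subseteq> V" "card G = k" "C \<subseteq> G"
  shows "card H \<le> (k - t) * ((card V - Suc t) choose (k - Suc t))"
proof (rule card_le_of_transversal_above[OF V C, where Y = "G - C"])
  have fC: "finite C" using C(1) V by (rule finite_subset)
  show "card (G - C) \<le> k - t" using G C fC by (simp add: card_Diff_subset)
  fix A assume A: "A \<in> H"
  show "A \<inter> (G - C) \<noteq> {}"
  proof
    assume "A \<inter> (G - C) = {}"
    then have "card (A \<inter> G) \<le> card C" using fC by (intro card_mono) auto
    then show False using H[OF A] C(2) by simp
  qed
qed (use G H in auto)

text \<open>Peeling \<open>H\<close> from \<open>q = k\<close> leaves, apart from at most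
  \<open>peel_bound\<close> many sets, those above \<open>T'\<close>. Their coefficient is
  \<open>k - t\<close> if \<open>T'\<close> is a kernel of all of \<open>\<F>\<close>,
  \<open>k + 1 - t\<close> if some member of \<open>\<F>\<close> does not contain the kernel, and
  \<open>t + 2\<close> if \<open>T'\<close> consists of sets of size \<open>t + 1\<close>.\<close>

lemma card_level:
  assumes V: "finite V" and t: "t < k"
    and \<F>: "\<And>A. A \<in> \<F> \<Longrightarrow> A \<subseteq> V \<and> card A = k"
    and H: "H \<subseteq> \<F>" "\<And>A B. A \<in> H \<Longrightarrow> B \<in> \<F> \<Longrightarrow> t \<le> card (A \<inter> B)"
    and kernel: "\<And>C. C \<subseteq> V \<Longrightarrow> card C = t \<Longrightarrow> \<forall>A\<in>\<F>. C \<subseteq> A \<Longrightarrow>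
      \<exists>G\<in>\<F>. \<forall>A\<in>H. t < card (A \<inter> G)"
  shows "card H \<le> max (t + 2) (k - t + 1) * ((card V - Suc t) choose (k - Suc t))
    + peel_bound (card V) k t k"
proof -
  let ?N = "(card V - Suc t) choose (k - Suc t)"
  have "t_intersecting t H" using H unfolding t_intersecting_def by auto
  moreover have "A \<subseteq> V \<and> card A \<le> k" if "A \<in> H" for A using that H(1) \<F> by auto
  ultimately obtain T' where T': "peel_base V t T'"
    "card (upper V k H - upper V k T') \<le> peel_bound (card V) k t k"
    using peeling[OF V, of t H k k] t by auto
  have fH: "finite H" using H(1) \<F> V by (meson PowI finite_Pow_iff finite_subset subset_iff)
  have "card (H \<inter> upper V k T') \<le> max (t + 2) (k - t + 1) * ?N"
    using T'(1) unfolding peel_base_def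
  proof (elim disjE exE conjE)
    fix C assume C: "C \<subseteq> V" "card C = t" "T' = {C}"
    have H': "G \<subseteq> V \<and> card G = k \<and> C \<subseteq> G" if "G \<in> H \<inter> upper V k T'" for G
      using that unfolding upper_def C(3) by auto
    show ?thesis
    proof (cases "\<forall>A\<in>\<F>. C \<subseteq> A")
      case True
      then obtain G where G: "G \<in> \<F>" "\<forall>A\<in>H. t < card (A \<inter> G)" using kernel C by blast
      have "card (H \<inter> upper V k T') \<le> (k - t) * ?N"
        using G \<F>[OF G(1)] True H' by (intro card_level_above_kernel[OF V C(1,2) t, of _ G]) auto
      also have "\<dots> \<le> max (t + 2) (k - t + 1) * ?N" by (intro mult_right_mono) auto
      finally show ?thesis .
    next
      case False
      then obtain F where F: "F \<in> \<F>" "\<not> C \<subseteq> F" by auto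
      have fC: "finite C" using C(1) V by (rule finite_subset)
      have fF: "finite F" "card F \<le> k" using \<F>[OF F(1)] V finite_subset by auto
      have cF: "card (C \<inter> F) < t" using psubset_card_mono[OF fC, of "C \<inter> F"] F(2) C(2) by auto
      obtain Y where Y: "Y \<subseteq> F - C" "card Y \<le> k + 1 - t"
        "\<And>A. C \<subseteq> A \<Longrightarrow> t \<le> card (A \<inter> F) \<Longrightarrow> A \<inter> Y \<noteq> {}"
        by (rule obtain_transversal[OF fF cF]) (rule that)
      have "card (H \<inter> upper V k T') \<le> (k + 1 - t) * ?N"
      proof (rule card_le_of_transversal_above[OF V C(1,2) t H' _ Y(2)])
        show "Y \<subseteq> V - C" using Y(1) \<F>[OF F(1)] by auto
        show "G \<inter> Y \<noteq> {}" if "G \<in> H \<inter> upper V k T'" for G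
          using that H' H(2)[OF _ F(1)] Y(3) by auto
      qed
      also have "\<dots> \<le> max (t + 2) (k - t + 1) * ?N" using t by (intro mult_right_mono) auto
      finally show ?thesis .
    qed
  next
    assume T: "finite T'" "card T' \<le> t + 2" "\<forall>A\<in>T'. A \<subseteq> V \<and> card A = Suc t"
    have "card (H \<inter> upper V k T') \<le> card (upper V k T')"
      using finite_upper[OF V] by (intro card_mono) auto
    also have "\<dots> \<le> card T' * ?N" using T t by (intro card_upper_le V) auto
    also have "\<dots> \<le> max (t + 2) (k - t + 1) * ?N" using T(2) by (intro mult_right_mono) auto
    finally show ?thesis .
  qed
  moreover have "H \<subseteq> upper V k H"
  proof
    fix A assume A: "A \<in> H"
    then show "A \<in> upper V k H" using \<F>[of A] H(1) unfolding upper_def by auto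
  qed
  then have "card H \<le> card ((H \<inter> upper V k T') \<union> (upper V k H - upper V k T'))"
    using fH finite_upper[OF V] by (intro card_mono) auto
  moreover have "\<dots> \<le> card (H \<inter> upper V k T') + card (upper V k H - upper V k T')"
    by (rule card_Un_le)
  ultimately show ?thesis using T'(2) by linarith
qed

section \<open>Stars and families with a kernel\<close>

lemma k_subsetsD: "A \<in> k_subsets n k \<Longrightarrow> A \<subseteq> {1..n} \<and> card A = k"
  unfolding k_subsets_def by simp

lemma finite_k_subsets: "finite (k_subsets n k)"
  unfolding k_subsets_def by simp

lemma min_inter_le: "finite \<F> \<Longrightarrow> B \<in> \<F> \<Longrightarrow> min_inter \<F> A \<le> card (A \<inter> B)"
  unfolding min_inter_def by (rule Min_le) auto

lemma le_min_inter:
  "finite \<F> \<Longrightarrow> \<F> \<noteq> {} \<Longrightarrow> (\<And>B. B \<in> \<F> \<Longrightarrow> c \<le> card (A \<inter> B)) \<Longrightarrow> c \<le> min_inter \<F> A"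
  unfolding min_inter_def by (subst Min_ge_iff) auto

lemma Phi_const:
  "(\<And>A. A \<in> \<F> \<Longrightarrow> min_inter \<F> A = c) \<Longrightarrow>
    Phi n k \<F> = real (card \<F>) / real ((n - c) choose (k - c))"
  unfolding Phi_def by simp

lemma card_star:
  assumes "C \<subseteq> {1..n}" "card C \<le> k"
  shows "card {A \<in> k_subsets n k. C \<subseteq> A} = (n - card C) choose (k - card C)"
proof -
  have "{A \<in> k_subsets n k. C \<subseteq> A} = {G. G \<subseteq> {1..n} \<and> card G = k \<and> C \<subseteq> G}"
    unfolding k_subsets_def by auto
  then show ?thesis using card_supersets[of "{1..n}" C k] assms by simp
qed

text \<open>Since \<open>n >= 2 * k\<close>, \<open>C\<close> can be completed to a
  \<open>k\<close>-set by points outside \<open>A\<close>; the result meets \<open>A\<close> exactly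
  in \<open>C\<close>.\<close>

lemma min_inter_star:
  assumes C: "C \<subseteq> {1..n}" "card C \<le> k" and n: "2 * k \<le> n"
    and A: "A \<in> k_subsets n k" "C \<subseteq> A"
  shows "min_inter {A \<in> k_subsets n k. C \<subseteq> A} A = card C"
proof (rule antisym)
  let ?S = "{A \<in> k_subsets n k. C \<subseteq> A}"
  have fS: "finite ?S" using finite_k_subsets by simp
  have fA: "finite A" "card A = k" "A \<subseteq> {1..n}" using k_subsetsD[OF A(1)] finite_subset by auto
  have fC: "finite C" using C(1) finite_subset by blast
  have "card ({1..n} - A) = n - k" using fA by (simp add: card_Diff_subset)
  then have "k - card C \<le> card ({1..n} - A)" using n by simp
  then obtain D where D: "D \<subseteq> {1..n} - A" "card D = k - card C"
    using obtain_subset_with_card_n by metis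
  have fD: "finite D" using D(1) by (meson finite_Diff finite_atLeastAtMost finite_subset)
  have "card (C \<union> D) = k" using D A(2) fC fD C(2) by (subst card_Un_disjoint) auto
  then have "C \<union> D \<in> ?S" using C(1) D(1) unfolding k_subsets_def by auto
  then have "min_inter ?S A \<le> card (A \<inter> (C \<union> D))" by (rule min_inter_le[OF fS])
  also have "A \<inter> (C \<union> D) = C" using A(2) D(1) by auto
  finally show "min_inter ?S A \<le> card C" .
  show "card C \<le> min_inter ?S A"
  proof (rule le_min_inter[OF fS])
    show "?S \<noteq> {}" using A by auto
    show "card C \<le> card (A \<inter> B)" if "B \<in> ?S" for B
      using that A(2) fA(1) by (intro card_mono) auto
  qed
qed

lemma Phi_star:
  assumes "is_star n k c \<F>" "c \<le> k" "2 * k \<le> n"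
  shows "Phi n k \<F> = 1"
proof -
  obtain C where C: "C \<subseteq> {1..n}" "card C = c" "\<F> = {A \<in> k_subsets n k. C \<subseteq> A}"
    using assms(1) unfolding is_star_def by auto
  have "Phi n k \<F> = real (card \<F>) / real ((n - c) choose (k - c))"
  proof (rule Phi_const)
    fix A assume "A \<in> \<F>"
    then show "min_inter \<F> A = c"
      unfolding C(3) C(2)[symmetric] using C(1,2) assms(2,3) by (intro min_inter_star) auto
  qed
  moreover have "card \<F> = (n - c) choose (k - c)"
    unfolding C(3) C(2)[symmetric] using C(1,2) assms(2) by (intro card_star) auto
  moreover have "0 < (n - c) choose (k - c)" using assms(2,3) by simp
  ultimately show ?thesis by simp
qed

text \<open>With constant weights, \<open>Phi\<close> is the size of \<open>\<F>\<close> over that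
  of the star containing it, so the value 1 forces equality of the two.\<close>

lemma Phi_kernel:
  assumes \<F>: "\<F> \<subseteq> k_subsets n k" "\<F> \<noteq> {}" and n: "2 * k \<le> n"
    and C: "\<And>A. A \<in> \<F> \<Longrightarrow> C \<subseteq> A \<and> min_inter \<F> A = card C"
  shows "Phi n k \<F> \<le> 1 \<and> (Phi n k \<F> = 1 \<longrightarrow> (\<exists>c\<le>k. is_star n k c \<F>))"
proof -
  let ?S = "{A \<in> k_subsets n k. C \<subseteq> A}"
  obtain A where A: "A \<in> \<F>" using \<F>(2) by auto
  have A': "finite A" "A \<subseteq> {1..n}" "card A = k"
    using A \<F>(1) k_subsetsD[of A n k] finite_subset by auto
  have CV: "C \<subseteq> {1..n}" using C[OF A] A' by auto
  have ck: "card C \<le> k" using C[OF A] A' card_mono by metis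
  have FS: "\<F> \<subseteq> ?S" using \<F>(1) C by auto
  have fS: "finite ?S" using finite_k_subsets by simp
  have cS: "card ?S = (n - card C) choose (k - card C)" using CV ck by (rule card_star)
  have pos: "0 < (n - card C) choose (k - card C)" using ck n by simp
  have P: "Phi n k \<F> = real (card \<F>) / real (card ?S)"
    unfolding cS using C by (intro Phi_const) auto
  have "card \<F> \<le> card ?S" using FS fS by (rule card_mono[rotated])
  then have "Phi n k \<F> \<le> 1" unfolding P using pos cS by simp
  moreover have "is_star n k (card C) \<F>" if "Phi n k \<F> = 1"
  proof -
    have "card \<F> = card ?S" using that pos cS unfolding P by simp
    then have "\<F> = ?S" using FS fS card_subset_eq by blast
    then show ?thesis unfolding is_star_def using CV by blast
  qed
  ultimately show ?thesis using ck by auto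
qed

section \<open>Families without a kernel\<close>

lemma binomial_pred_quotient:
  assumes "t < k" "k \<le> n"
  shows "real ((n - Suc t) choose (k - Suc t)) / real ((n - t) choose (k - t))
    = (real k - real t) / (real n - real t)"
proof -
  define N K where "N = n - Suc t" and "K = k - Suc t"
  have NK: "n - t = Suc N" "k - t = Suc K" "real n - real t = real (Suc N)"
    "real k - real t = real (Suc K)" "K \<le> N"
    using assms unfolding N_def K_def by auto
  have "real (Suc K) * real (Suc N choose Suc K) = real (Suc N) * real (N choose K)"
    by (simp only: of_nat_mult[symmetric] Suc_times_binomial)
  moreover have "0 < Suc N choose Suc K" using NK(5) by (simp del: binomial_Suc_Suc)
  ultimately show ?thesis
    unfolding NK N_def[symmetric] K_def[symmetric] by (simp add: field_simps del: binomial_Suc_Suc)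
qed

text \<open>Each level is bounded by its summand of \<open>level_total\<close>. Applied to
  \<open>C = {}\<close>, hypothesis \<open>nk\<close> also shows that \<open>\<F>\<close> is
  nonempty.\<close>

lemma Phi_less_1:
  assumes k: "1 \<le> k" and \<F>: "\<F> \<subseteq> k_subsets n k"
    and n: "real k * (real k + 1)^2 / 2 \<le> real n"
    and nk: "\<And>C. C \<subseteq> {1..n} \<Longrightarrow> \<exists>A\<in>\<F>. \<not> (C \<subseteq> A \<and> min_inter \<F> A = card C)"
  shows "Phi n k \<F> < 1"
proof -
  let ?i = "min_inter \<F>"
  define L where "L t = {A \<in> \<F>. ?i A = t}" for t
  define N where "N t = (n - Suc t) choose (k - Suc t)" for t
  have kn: "k \<le> n" using two_k_le_threshold[OF k] n by linarith
  have fF: "finite \<F>" using \<F> finite_k_subsets finite_subset by blast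
  have F: "A \<subseteq> {1..n} \<and> card A = k" "finite A" if "A \<in> \<F>" for A
    using that \<F> k_subsetsD[of A n k] finite_subset by auto
  \<comment> \<open>If \<open>A\<close> had minimum \<open>k\<close>, every member would equal
    \<open>A\<close>, and \<open>C = A\<close> would contradict \<open>nk\<close>.\<close>
  have lt: "?i A < k" if A: "A \<in> \<F>" for A
  proof (rule ccontr)
    assume "\<not> ?i A < k"
    moreover have "?i A \<le> k" using min_inter_le[OF fF A, of A] F[OF A] by simp
    ultimately have i: "?i A = k" by simp
    have "B = A" if B: "B \<in> \<F>" for B
    proof -
      have "card A \<le> card (A \<inter> B)" using min_inter_le[OF fF B, of A] i F[OF A] by simp
      then have "A \<inter> B = A" using F(2)[OF A] by (intro card_seteq) auto
      then show ?thesis using card_subset_eq[of B A] F[OF A] F[OF B] by auto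
    qed
    then show False using nk[of A] F[OF A] i by auto
  qed
  have level: "t \<le> card (A \<inter> B)" if "A \<in> L t" "B \<in> \<F>" for t A B
    using that min_inter_le[OF fF that(2), of A] unfolding L_def by simp
  \<comment> \<open>As \<open>C\<close> lies in all members, each minimum is at least
    \<open>t\<close>; \<open>nk\<close> provides a \<open>G\<close> whose minimum is larger, so
    \<open>G\<close> meets every member in more than \<open>t\<close> points.\<close>
  have kernel: "\<exists>G\<in>\<F>. \<forall>A\<in>L t. t < card (A \<inter> G)"
    if C: "C \<subseteq> {1..n}" "card C = t" "\<forall>A\<in>\<F>. C \<subseteq> A" for C t
  proof -
    obtain G where G: "G \<in> \<F>" "?i G \<noteq> t" using nk[OF C(1)] C(2,3) by auto
    have "t \<le> ?i G"
    proof (rule le_min_inter[OF fF])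
      fix B assume "B \<in> \<F>"
      then show "t \<le> card (G \<inter> B)"
        unfolding C(2)[symmetric] using C(3) G(1) F(2)[OF G(1)] by (intro card_mono) auto
    qed (use G(1) in auto)
    then have "t < card (A \<inter> G)" if "A \<in> L t" for A
      using min_inter_le[OF fF, of A G] that G(2) unfolding L_def by (auto simp: Int_commute)
    then show ?thesis using G(1) by auto
  qed
  have "Phi n k \<F> = (\<Sum>t<k. \<Sum>A\<in>L t. 1 / real ((n - ?i A) choose (k - ?i A)))"
    unfolding Phi_def L_def using fF lt by (intro sum.group[symmetric]) auto
  also have "\<dots> = (\<Sum>t<k. real (card (L t)) / real ((n - t) choose (k - t)))"
    unfolding L_def by (intro sum.cong refl) simp
  also have "{..<k} = insert 0 {1..<k}" using k by auto
  also have "(\<Sum>t\<in>insert 0 {1..<k}. real (card (L t)) / real ((n - t) choose (k - t)))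
      = real (card (L 0)) / real (n choose k)
        + (\<Sum>t=1..<k. real (card (L t)) / real ((n - t) choose (k - t)))" by simp
  finally have eq: "Phi n k \<F> = real (card (L 0)) / real (n choose k)
      + (\<Sum>t=1..<k. real (card (L t)) / real ((n - t) choose (k - t)))" .
  have "Phi n k \<F> \<le> level_total k (real n)"
    unfolding eq level_total_def
  proof (intro add_mono sum_mono)
    \<comment> \<open>The empty set lies in every member, so \<open>kernel\<close> applies with
      \<open>t = 0\<close> and level 0 is bounded without peeling.\<close>
    obtain G where G: "G \<in> \<F>" "\<forall>A\<in>L 0. 0 < card (A \<inter> G)" using kernel[of "{}" 0] by auto
    have "card (L 0) \<le> (k - 0) * ((card {1..n} - Suc 0) choose (k - Suc 0))"
      using G F k by (intro card_level_above_kernel[of _ "{}" _ _ _ G]) (auto simp: L_def)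
    then have "real (card (L 0)) \<le> real k * real (N 0)"
      unfolding N_def of_nat_mult[symmetric] of_nat_le_iff by simp
    then have "real (card (L 0)) / real (n choose k) \<le> real k * (real (N 0) / real (n choose k))"
      by (simp add: divide_right_mono)
    also have "real (N 0) / real (n choose k) = real k / real n"
      using binomial_pred_quotient[of 0 k n] k kn unfolding N_def by simp
    finally show "real (card (L 0)) / real (n choose k) \<le> real k ^ 2 / real n"
      by (simp add: power2_eq_square)
  next
    fix t assume t: "t \<in> {1..<k}"
    have "card (L t) \<le> max (t + 2) (k - t + 1) * N t + peel_bound n k t k"
      using card_level[of "{1..n}" t k \<F> "L t"] t F(1) level kernel unfolding N_def L_def by simp
    then have "real (card (L t)) \<le> real (max (t + 2) (k - t + 1) * N t + peel_bound n k t k)"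
      by (rule of_nat_mono)
    also have "\<dots> = (real (max (t + 2) (k - t + 1)) + peel_ratio k t (real n)) * real (N t)"
      unfolding of_nat_add of_nat_mult N_def using t kn
      by (subst peel_bound_eq) (auto simp: algebra_simps)
    finally have "real (card (L t)) / real ((n - t) choose (k - t))
        \<le> (real (max (t + 2) (k - t + 1)) + peel_ratio k t (real n))
          * (real (N t) / real ((n - t) choose (k - t)))"
      by (simp add: divide_right_mono)
    also have "real (N t) / real ((n - t) choose (k - t)) = (real k - real t) / (real n - real t)"
      unfolding N_def using t kn by (intro binomial_pred_quotient) auto
    finally show "real (card (L t)) / real ((n - t) choose (k - t)) \<le> (real k - real t) / (real n - real t)
        * (real (max (t + 2) (k - t + 1)) + peel_ratio k t (real n))"
      by (simp only: mult.commute)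
  qed
  then show ?thesis using level_total_less_1[OF k n] by linarith
qed

theorem theorem1p1:
  fixes n k :: nat and \<F> :: "nat set set"
  assumes "k \<ge> 1"
    and "\<F> \<subseteq> k_subsets n k"
    and "real n \<ge> (real k ^ 3 + 2 * real k ^ 2 + real k) / 2"
  shows "Phi n k \<F> \<le> 1 \<and> (Phi n k \<F> = 1 \<longleftrightarrow> (\<exists>c\<le>k. is_star n k c \<F>))"
proof -
  have n: "real k * (real k + 1)^2 / 2 \<le> real n"
    using assms(3) by (simp add: power2_eq_square power3_eq_cube algebra_simps)
  then have n2: "2 * k \<le> n" using two_k_le_threshold[OF assms(1)] by linarith
  have "Phi n k \<F> \<le> 1 \<and> (Phi n k \<F> = 1 \<longrightarrow> (\<exists>c\<le>k. is_star n k c \<F>))"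
  \<comment> \<open>Nonemptiness is asked for because every \<open>C\<close> works vacuously for the
    empty family. In the second case the value is strictly below 1, so equality cannot
    arise.\<close>
  proof (cases "\<F> \<noteq> {} \<and> (\<exists>C. \<forall>A\<in>\<F>. C \<subseteq> A \<and> min_inter \<F> A = card C)")
    case True
    then obtain C where "\<F> \<noteq> {}" "\<And>A. A \<in> \<F> \<Longrightarrow> C \<subseteq> A \<and> min_inter \<F> A = card C" by auto
    then show ?thesis by (rule Phi_kernel[OF assms(2) _ n2])
  next
    case False
    have "Phi n k \<F> < 1"
    proof (cases "\<F> = {}")
      case True
      then show ?thesis by (simp add: Phi_def)
    next
      case nonempty: False
      then show ?thesis using False Phi_less_1[OF assms(1,2) n] by blast
    qed
    then show ?thesis by simp
  qed
  then show ?thesis using Phi_star[OF _ _ n2] by blast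
qed

end
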